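(* Let $\mathcal{A}$ be a Hopf algebra with coproduct $\Delta$, and let $\mathcal{B},\mathcal{C}\subset\mathcal{A}$ be Hopf subalgebras which are carriers for twisting elements $\mathcal{F}_{\mathcal{B}}\in\mathcal{B}\otimes\mathcal{B}$ and $\mathcal{F}_{\mathcal{C}}\in\mathcal{C}\otimes\mathcal{C}$ respectively. Suppose that $\mathcal{F}_{\mathcal{B}}$ commutes with $\Delta(\mathcal{C})$, i.e. $\mathcal{F}_{\mathcal{B}}\,\Delta(c)=\Delta(c)\,\mathcal{F}_{\mathcal{B}}$ for all $c\in\mathcal{C}$. Then: (i) $\mathcal{C}$ is stable with respect to $\mathcal{F}_{\mathcal{B}}$, i.e. $\Delta_{\mathcal{F}_{\mathcal{B}}}(c)=\Delta(c)$ for all $c\in\mathcal{C}$; (ii) $\mathcal{F}_{\mathcal{C}}$ is a twisting element for the twisted Hopf algebra $\mathcal{A}_{\mathcal{F}_{\mathcal{B}}}$; (iii) the product $\mathcal{F}_{\mathcal{C}}\mathcal{F}_{\mathcal{B}}$ is a twisting element for $\mathcal{A}$.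
   Context: Let $\mathcal{A}$ be a Hopf algebra with multiplication $m$, coproduct $\Delta$, counit $\epsilon$, antipode $S$. A twisting element (twist) for $\mathcal{A}$ is an invertible $\mathcal{F}=\sum_i f_i^{(1)}\otimes f_i^{(2)}\in\mathcal{A}\otimes\mathcal{A}$ with $$(\epsilon\otimes \mathrm{id})(\mathcal{F})=(\mathrm{id}\otimes\epsilon)(\mathcal{F})=1,\qquad \mathcal{F}_{12}\,(\Delta\otimes \mathrm{id})(\mathcal{F})=\mathcal{F}_{23}\,(\mathrm{id}\otimes\Delta)(\mathcal{F}).$$ The twisted Hopf algebra $\mathcal{A}_{\mathcal{F}}$ has the same multiplication and counit as $\mathcal{A}$, with coproduct $\Delta_{\mathcal{F}}(a)=\mathcal{F}\Delta(a)\mathcal{F}^{-1}$ and antipode $S_{\mathcal{F}}(a)=vS(a)v^{-1}$, where $v=\sum_i f_i^{(1)}S(f_i^{(2)})$. A twisting element for $\mathcal{A}_{\mathcal{F}}$ is an invertible $\mathcal{G}\in\mathcal{A}\otimes\mathcal{A}$ satisfying $(\epsilon\otimes \mathrm{id})(\mathcal{G})=(\mathrm{id}\otimes\epsilon)(\mathcal{G})=1$ and $\mathcal{G}_{12}\,(\Delta_{\mathcal{F}}\otimes \mathrm{id})(\mathcal{G})=\mathcal{G}_{23}\,(\mathrm{id}\otimes\Delta_{\mathcal{F}})(\mathcal{G})$. A Hopf subalgebra $\mathcal{B}\subset\mathcal{A}$ is a carrier for a twisting element $\mathcal{F}$ if $\mathcal{F}$ is completely defined on $\mathcal{B}$, i.e.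 $\mathcal{F}\in\mathcal{B}\otimes\mathcal{B}$ is a twisting element of $\mathcal{B}$, and $\mathcal{B}$ is minimal among Hopf subalgebras with this property. *)

theory Defs
  imports Complex_Main "HOL-Library.Poly_Mapping"
begin

section \<open>Formal linear combinations\<close>

definition fscale :: "'k::field \<Rightarrow> ('x \<Rightarrow>\<^sub>0 'k) \<Rightarrow> ('x \<Rightarrow>\<^sub>0 'k)" where
  "fscale c p = Poly_Mapping.map (\<lambda>d. c * d) p"

lemma lookup_fscale [simp]: "Poly_Mapping.lookup (fscale c p) x = c * Poly_Mapping.lookup p x"
  by (cases "Poly_Mapping.lookup p x = 0") (simp_all add: fscale_def Poly_Mapping.map.rep_eq)

global_interpretation formal: vector_space "fscale :: 'k::field \<Rightarrow> ('x \<Rightarrow>\<^sub>0 'k) \<Rightarrow> _"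
  by unfold_locales (auto intro!: poly_mapping_eqI simp: lookup_add algebra_simps)

definition single :: "'x \<Rightarrow> ('x \<Rightarrow>\<^sub>0 'k::field)" where
  "single x = Poly_Mapping.single x 1"

text \<open>The linear extension of a map \<open>f\<close> on basis elements, into a space with scalar
  multiplication \<open>sc\<close>.\<close>

definition lin :: "('k \<Rightarrow> 'v \<Rightarrow> 'v) \<Rightarrow> ('x \<Rightarrow> 'v) \<Rightarrow> ('x \<Rightarrow>\<^sub>0 'k::field) \<Rightarrow> 'v::ab_group_add" where
  "lin sc f p = (\<Sum>x\<in>Poly_Mapping.keys p. sc (Poly_Mapping.lookup p x) (f x))"


section \<open>Tensor squares and cubes\<close>

text \<open>The tensor square (cube) of a \<open>'k\<close>-space \<open>'a\<close> with scalar multiplication \<open>s\<close> is the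
  free space on pairs (triples) modulo the subspace generated by the bilinearity (trilinearity)
  relations. The relations depend on the term \<open>s\<close>, so the quotient is not a type: its elements
  are the cosets of that subspace. In \<open>slot_rels s g\<close>, the map \<open>g\<close> inserts its
  argument into one slot of a tuple whose other entries are fixed.\<close>

type_synonym ('k, 'a) tensor2 = "('a \<times> 'a \<Rightarrow>\<^sub>0 'k) set"
type_synonym ('k, 'a) tensor3 = "('a \<times> 'a \<times> 'a \<Rightarrow>\<^sub>0 'k) set"

definition slot_rels ::
    "('k::field \<Rightarrow> 'a::ring_1 \<Rightarrow> 'a) \<Rightarrow> ('a \<Rightarrow> 'x) \<Rightarrow> ('x \<Rightarrow>\<^sub>0 'k) set" where
  "slot_rels s g =
     {single (g (a + b)) - single (g a) - single (g b) | a b. True} \<union>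
     {single (g (s c a)) - fscale c (single (g a)) | c a. True}"

definition rels2 :: "('k::field \<Rightarrow> 'a::ring_1 \<Rightarrow> 'a) \<Rightarrow> ('a \<times> 'a \<Rightarrow>\<^sub>0 'k) set" where
  "rels2 s = formal.span
     ((\<Union>b. slot_rels s (\<lambda>x. (x, b))) \<union> (\<Union>a. slot_rels s (\<lambda>x. (a, x))))"

definition rels3 :: "('k::field \<Rightarrow> 'a::ring_1 \<Rightarrow> 'a) \<Rightarrow> ('a \<times> 'a \<times> 'a \<Rightarrow>\<^sub>0 'k) set" where
  "rels3 s = formal.span
     ((\<Union>b c. slot_rels s (\<lambda>x. (x, b, c))) \<union> (\<Union>a c. slot_rels s (\<lambda>x. (a, x, c)))
      \<union> (\<Union>a b. slot_rels s (\<lambda>x. (a, b, x))))"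

definition cls2 :: "('k::field \<Rightarrow> 'a::ring_1 \<Rightarrow> 'a) \<Rightarrow> ('a \<times> 'a \<Rightarrow>\<^sub>0 'k) \<Rightarrow> ('k, 'a) tensor2" where
  "cls2 s p = {q. q - p \<in> rels2 s}"

definition cls3 ::
    "('k::field \<Rightarrow> 'a::ring_1 \<Rightarrow> 'a) \<Rightarrow> ('a \<times> 'a \<times> 'a \<Rightarrow>\<^sub>0 'k) \<Rightarrow> ('k, 'a) tensor3" where
  "cls3 s p = {q. q - p \<in> rels3 s}"

text \<open>A representative of a coset. Every operation below is the (multi)linear extension of a
  map that respects the relations, so its value does not depend on this choice.\<close>

definition rep :: "('x \<Rightarrow>\<^sub>0 'k::field) set \<Rightarrow> ('x \<Rightarrow>\<^sub>0 'k)" where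
  "rep X = (SOME p. p \<in> X)"

text \<open>For a subspace \<open>B\<close>, the image of the tensor square of \<open>B\<close> in the tensor square of the whole
  space; since \<open>'k\<close> is a field the canonical map between the two is injective.\<close>

definition square :: "('k::field \<Rightarrow> 'a::ring_1 \<Rightarrow> 'a) \<Rightarrow> 'a set \<Rightarrow> ('k, 'a) tensor2 set" where
  "square s B = {cls2 s p | p. Poly_Mapping.keys p \<subseteq> B \<times> B}"

definition add2 :: "('k::field \<Rightarrow> 'a::ring_1 \<Rightarrow> 'a) \<Rightarrow>
    ('k, 'a) tensor2 \<Rightarrow> ('k, 'a) tensor2 \<Rightarrow> ('k, 'a) tensor2" where
  "add2 s X Y = cls2 s (rep X + rep Y)"

definition scale2 :: "('k::field \<Rightarrow> 'a::ring_1 \<Rightarrow> 'a) \<Rightarrow>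
    'k \<Rightarrow> ('k, 'a) tensor2 \<Rightarrow> ('k, 'a) tensor2" where
  "scale2 s c X = cls2 s (fscale c (rep X))"

definition one2 :: "('k::field \<Rightarrow> 'a::ring_1 \<Rightarrow> 'a) \<Rightarrow> ('k, 'a) tensor2" where
  "one2 s = cls2 s (single (1, 1))"

definition mult2 :: "('k::field \<Rightarrow> 'a::ring_1 \<Rightarrow> 'a) \<Rightarrow>
    ('k, 'a) tensor2 \<Rightarrow> ('k, 'a) tensor2 \<Rightarrow> ('k, 'a) tensor2" where
  "mult2 s X Y = cls2 s
     (lin fscale (\<lambda>(a, b). lin fscale (\<lambda>(a', b'). single (a * a', b * b')) (rep Y)) (rep X))"

definition mult3 :: "('k::field \<Rightarrow> 'a::ring_1 \<Rightarrow> 'a) \<Rightarrow>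
    ('k, 'a) tensor3 \<Rightarrow> ('k, 'a) tensor3 \<Rightarrow> ('k, 'a) tensor3" where
  "mult3 s X Y = cls3 s
     (lin fscale (\<lambda>(a, b, c). lin fscale (\<lambda>(a', b', c'). single (a * a', b * b', c * c')) (rep Y))
        (rep X))"

definition inverses2 :: "('k::field \<Rightarrow> 'a::ring_1 \<Rightarrow> 'a) \<Rightarrow>
    ('k, 'a) tensor2 \<Rightarrow> ('k, 'a) tensor2 \<Rightarrow> bool" where
  "inverses2 s X Y \<longleftrightarrow> mult2 s X Y = one2 s \<and> mult2 s Y X = one2 s"

definition inv2 :: "('k::field \<Rightarrow> 'a::ring_1 \<Rightarrow> 'a) \<Rightarrow> ('k, 'a) tensor2 \<Rightarrow> ('k, 'a) tensor2" where
  "inv2 s X = (THE Y. Y \<in> square s UNIV \<and> inverses2 s X Y)"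

text \<open>\<open>X\<^sub>1\<^sub>2 = X \<otimes> 1\<close> and \<open>X\<^sub>2\<^sub>3 = 1 \<otimes> X\<close>\<close>

definition leg12 :: "('k::field \<Rightarrow> 'a::ring_1 \<Rightarrow> 'a) \<Rightarrow> ('k, 'a) tensor2 \<Rightarrow> ('k, 'a) tensor3" where
  "leg12 s X = cls3 s (lin fscale (\<lambda>(a, b). single (a, b, 1)) (rep X))"

definition leg23 :: "('k::field \<Rightarrow> 'a::ring_1 \<Rightarrow> 'a) \<Rightarrow> ('k, 'a) tensor2 \<Rightarrow> ('k, 'a) tensor3" where
  "leg23 s X = cls3 s (lin fscale (\<lambda>(a, b). single (1, a, b)) (rep X))"


section \<open>Hopf algebras\<close>

text \<open>The underlying ring is the type \<open>'a\<close>; the record holds the remaining structure.\<close>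

record (overloaded) ('k::zero, 'a) hopf =
  scl :: "'k \<Rightarrow> 'a \<Rightarrow> 'a"
  comult :: "'a \<Rightarrow> ('k, 'a) tensor2"
  counit :: "'a \<Rightarrow> 'k"
  antipode :: "'a \<Rightarrow> 'a"

text \<open>\<open>(\<Delta> \<otimes> id)(X)\<close>, \<open>(id \<otimes> \<Delta>)(X)\<close>, \<open>(\<epsilon> \<otimes> id)(X)\<close>, \<open>(id \<otimes> \<epsilon>)(X)\<close>,
  \<open>m (S \<otimes> id)(X)\<close> and \<open>m (id \<otimes> S)(X)\<close>\<close>

definition comult_id :: "('k::field, 'a::ring_1) hopf \<Rightarrow> ('k, 'a) tensor2 \<Rightarrow> ('k, 'a) tensor3" where
  "comult_id H X = cls3 (scl H)
     (lin fscale (\<lambda>(a, b). lin fscale (\<lambda>(a', a''). single (a', a'', b)) (rep (comult H a))) (rep X))"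

definition id_comult :: "('k::field, 'a::ring_1) hopf \<Rightarrow> ('k, 'a) tensor2 \<Rightarrow> ('k, 'a) tensor3" where
  "id_comult H X = cls3 (scl H)
     (lin fscale (\<lambda>(a, b). lin fscale (\<lambda>(b', b''). single (a, b', b'')) (rep (comult H b))) (rep X))"

definition counit_id :: "('k::field, 'a::ring_1) hopf \<Rightarrow> ('k, 'a) tensor2 \<Rightarrow> 'a" where
  "counit_id H X = lin (scl H) (\<lambda>(a, b). scl H (counit H a) b) (rep X)"

definition id_counit :: "('k::field, 'a::ring_1) hopf \<Rightarrow> ('k, 'a) tensor2 \<Rightarrow> 'a" where
  "id_counit H X = lin (scl H) (\<lambda>(a, b). scl H (counit H b) a) (rep X)"

definition mult_antipode_id :: "('k::field, 'a::ring_1) hopf \<Rightarrow> ('k, 'a) tensor2 \<Rightarrow> 'a" where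
  "mult_antipode_id H X = lin (scl H) (\<lambda>(a, b). antipode H a * b) (rep X)"

definition mult_id_antipode :: "('k::field, 'a::ring_1) hopf \<Rightarrow> ('k, 'a) tensor2 \<Rightarrow> 'a" where
  "mult_id_antipode H X = lin (scl H) (\<lambda>(a, b). a * antipode H b) (rep X)"

locale hopf_algebra =
  fixes H :: "('k::field, 'a::ring_1) hopf"
  assumes vector_space: "vector_space (scl H)"
    and scl_mult_left: "scl H c a * b = scl H c (a * b)"
    and scl_mult_right: "a * scl H c b = scl H c (a * b)"
    and comult_closed: "comult H a \<in> square (scl H) UNIV"
    and comult_add: "comult H (a + b) = add2 (scl H) (comult H a) (comult H b)"
    and comult_scl: "comult H (scl H c a) = scale2 (scl H) c (comult H a)"
    and comult_mult: "comult H (a * b) = mult2 (scl H) (comult H a) (comult H b)"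
    and comult_one: "comult H 1 = one2 (scl H)"
    and coassoc: "comult_id H (comult H a) = id_comult H (comult H a)"
    and counit_linear: "Vector_Spaces.linear (scl H) (*) (counit H)"
    and counit_mult: "counit H (a * b) = counit H a * counit H b"
    and counit_one: "counit H 1 = 1"
    and counit_left: "counit_id H (comult H a) = a"
    and counit_right: "id_counit H (comult H a) = a"
    and antipode_linear: "Vector_Spaces.linear (scl H) (scl H) (antipode H)"
    and antipode_left: "mult_antipode_id H (comult H a) = scl H (counit H a) 1"
    and antipode_right: "mult_id_antipode H (comult H a) = scl H (counit H a) 1"

definition hopf_subalgebra :: "('k::field, 'a::ring_1) hopf \<Rightarrow> 'a set \<Rightarrow> bool" where
  "hopf_subalgebra H B \<longleftrightarrow>
     module.subspace (scl H) B \<and> 1 \<in> B \<and> (\<forall>a\<in>B. \<forall>b\<in>B. a * b \<in> B) \<and>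
     (\<forall>b\<in>B. comult H b \<in> square (scl H) B) \<and> (\<forall>b\<in>B. antipode H b \<in> B)"


section \<open>Twisting\<close>

text \<open>Twisting elements of a Hopf subalgebra \<open>B\<close>; those of the whole Hopf algebra are the case
  \<open>B = UNIV\<close>. The inverse is required to lie in the tensor square of \<open>B\<close> as well.\<close>

definition twisting_element ::
    "('k::field, 'a::ring_1) hopf \<Rightarrow> 'a set \<Rightarrow> ('k, 'a) tensor2 \<Rightarrow> bool" where
  "twisting_element H B F \<longleftrightarrow>
     F \<in> square (scl H) B \<and>
     (\<exists>G\<in>square (scl H) B. inverses2 (scl H) F G) \<and>
     counit_id H F = 1 \<and> id_counit H F = 1 \<and>
     mult3 (scl H) (leg12 (scl H) F) (comult_id H F) =
     mult3 (scl H) (leg23 (scl H) F) (id_comult H F)"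

definition twisted ::
    "('k::field, 'a::ring_1) hopf \<Rightarrow> ('k, 'a) tensor2 \<Rightarrow> ('k, 'a) hopf" where
  "twisted H F =
     (let v = mult_id_antipode H F;
          v' = (THE w. v * w = 1 \<and> w * v = 1)
      in H\<lparr>comult := \<lambda>a. mult2 (scl H) (mult2 (scl H) F (comult H a)) (inv2 (scl H) F),
           antipode := \<lambda>a. v * antipode H a * v'\<rparr>)"

definition carrier_of ::
    "('k::field, 'a::ring_1) hopf \<Rightarrow> 'a set \<Rightarrow> ('k, 'a) tensor2 \<Rightarrow> bool" where
  "carrier_of H B F \<longleftrightarrow>
     hopf_subalgebra H B \<and> twisting_element H B F \<and>
     (\<forall>B'. hopf_subalgebra H B' \<and> twisting_element H B' F \<and> B' \<subseteq> B \<longrightarrow> B' = B)"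

end

theory Submission
  imports Defs
begin

text \<open>Since \<open>\<F>\<^sub>B\<close> commutes with \<open>\<Delta>(C)\<close>, its legs \<open>(\<F>\<^sub>B)\<^sub>1\<^sub>2\<close> and \<open>(\<F>\<^sub>B)\<^sub>2\<^sub>3\<close> commute with
  \<open>(\<Delta> \<otimes> id)(\<F>\<^sub>C)\<close> and \<open>(id \<otimes> \<Delta>)(\<F>\<^sub>C)\<close> respectively, because \<open>\<F>\<^sub>C\<close> has a representative
  supported on \<open>C \<times> C\<close>. As \<open>\<Delta> \<otimes> id\<close> and \<open>id \<otimes> \<Delta>\<close> are multiplicative, the cocycle equation for
  \<open>\<F>\<^sub>C \<F>\<^sub>B\<close> is then the product of those for \<open>\<F>\<^sub>C\<close> and \<open>\<F>\<^sub>B\<close>.\<close>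

section \<open>Linear extension\<close>

context vector_space
begin

text \<open>Coefficients off the support vanish. Enlarging the index set lets combinations with
  different supports be summed over one common set.\<close>

lemma lin_superset:
  assumes "finite K" "Poly_Mapping.keys p \<subseteq> K"
  shows "lin scale f p = (\<Sum>x\<in>K. scale (Poly_Mapping.lookup p x) (f x))"
  unfolding lin_def using assms
  by (intro sum.mono_neutral_left) (auto simp: in_keys_iff)

lemma lin_zero [simp]: "lin scale f 0 = 0"
  by (simp add: lin_def)

lemma lin_single [simp]: "lin scale f (single x) = f x"
  by (simp add: lin_def single_def)

lemma lin_add: "lin scale f (p + q) = lin scale f p + lin scale f q"
proof -
  let ?K = "Poly_Mapping.keys p \<union> Poly_Mapping.keys q"
  have "Poly_Mapping.keys (p + q) \<subseteq> ?K"
    by (rule Poly_Mapping.keys_add)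
  then show ?thesis
    by (simp add: lin_superset[where K = ?K] lookup_add scale_left_distrib sum.distrib)
qed

lemma lin_fscale: "lin scale f (fscale c p) = scale c (lin scale f p)"
proof -
  let ?K = "Poly_Mapping.keys p"
  have "Poly_Mapping.keys (fscale c p) \<subseteq> ?K"
    by (auto simp: in_keys_iff)
  then show ?thesis
    by (simp add: lin_superset[where K = ?K] scale_sum_right)
qed

lemma lin_diff: "lin scale f (p - q) = lin scale f p - lin scale f q"
  using lin_add[of f "p - q" q] by simp

lemma lin_fun_add: "lin scale (\<lambda>x. f x + g x) p = lin scale f p + lin scale g p"
  by (simp add: lin_def scale_right_distrib sum.distrib)

lemma lin_fun_scale: "lin scale (\<lambda>x. scale c (f x)) p = scale c (lin scale f p)"
  by (simp add: lin_def scale_sum_right scale_left_commute mult.commute)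

lemma lin_fun_zero [simp]: "lin scale (\<lambda>x. 0) p = 0"
  by (simp add: lin_def)

end

text \<open>A formal combination is a finite sum of scaled basis elements. The set \<open>K\<close>
  keeps the support condition at hand in the basis case, which later supplies entries lying in
  \<open>C\<close>.\<close>

lemma formal_induct [consumes 1, case_names zero single add scale]:
  assumes "Poly_Mapping.keys p \<subseteq> K"
    and "P 0"
    and "\<And>x. x \<in> K \<Longrightarrow> P (single x)"
    and add: "\<And>p q. P p \<Longrightarrow> P q \<Longrightarrow> P (p + q)"
    and scale: "\<And>c p. P p \<Longrightarrow> P (fscale c p)"
  shows "P p"
proof -
  have eq: "p = (\<Sum>x\<in>Poly_Mapping.keys p. fscale (Poly_Mapping.lookup p x) (single x))"
    by (rule poly_mapping_eqI)
      (auto simp: lookup_sum single_def lookup_single when_def in_keys_iff if_distrib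
        cong: if_cong)
  \<comment> \<open>The coefficients of \<open>p\<close> stay fixed while the index set
    \<open>A\<close> grows, so induction on \<open>A\<close> leaves \<open>p\<close>
    untouched.\<close>
  have "P (\<Sum>x\<in>A. fscale (Poly_Mapping.lookup p x) (single x))"
    if "finite A" "A \<subseteq> K" for A
    using that by (induction A) (auto intro!: assms)
  from this[of "Poly_Mapping.keys p"] assms(1) show ?thesis
    by (subst eq) simp
qed

lemma formal_induct_UNIV [case_names zero single add scale]:
  assumes "P 0"
    and "\<And>x. P (single x)"
    and "\<And>p q. P p \<Longrightarrow> P q \<Longrightarrow> P (p + q)"
    and "\<And>c p. P p \<Longrightarrow> P (fscale c p)"
  shows "P p"
  by (rule formal_induct[of p UNIV]) (use assms in auto)

section \<open>Push-forward and bilinear extension of formal combinations\<close>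

definition fmap :: "('x \<Rightarrow> 'y) \<Rightarrow> ('x \<Rightarrow>\<^sub>0 'k::field) \<Rightarrow> ('y \<Rightarrow>\<^sub>0 'k)" where
  "fmap h = lin fscale (\<lambda>x. single (h x))"

definition conv ::
    "('x \<Rightarrow> 'y \<Rightarrow> 'z) \<Rightarrow> ('x \<Rightarrow>\<^sub>0 'k::field) \<Rightarrow> ('y \<Rightarrow>\<^sub>0 'k) \<Rightarrow> ('z \<Rightarrow>\<^sub>0 'k)" where
  "conv h p q = lin fscale (\<lambda>x. lin fscale (\<lambda>y. single (h x y)) q) p"

lemma fmap_simps [simp]:
  "fmap h 0 = 0"
  "fmap h (single x) = single (h x)"
  "fmap h (p + q) = fmap h p + fmap h q"
  "fmap h (p - q) = fmap h p - fmap h q"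
  "fmap h (fscale c p) = fscale c (fmap h p)"
  by (simp_all add: fmap_def formal.lin_add formal.lin_diff formal.lin_fscale)

lemma fmap_ident [simp]: "fmap (\<lambda>x. x) p = p"
  by (induction p rule: formal_induct_UNIV) simp_all

lemma conv_simps [simp]:
  "conv h 0 q = 0"
  "conv h (single x) q = fmap (h x) q"
  "conv h (p + p') q = conv h p q + conv h p' q"
  "conv h (fscale c p) q = fscale c (conv h p q)"
  "conv h p 0 = 0"
  "conv h p (single y) = fmap (\<lambda>x. h x y) p"
  "conv h p (q + q') = conv h p q + conv h p q'"
  "conv h p (fscale c q) = fscale c (conv h p q)"
  by (simp_all add: conv_def fmap_def formal.lin_add formal.lin_fscale
      formal.lin_fun_add formal.lin_fun_scale)

lemma conv_diff [simp]:
  "conv h (p - p') q = conv h p q - conv h p' q"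
  "conv h p (q - q') = conv h p q - conv h p q'"
  by (simp_all add: eq_diff_eq flip: conv_simps(3,7))

text \<open>By bilinearity, an intertwining relation between \<open>h\<close> and \<open>h'\<close>
  need only be checked on basis elements. This is the source of every multiplicativity statement
  about legs and coproducts below.\<close>

lemma fmap_conv:
  assumes "\<And>x y. k (h x y) = h' (k1 x) (k2 y)"
  shows "fmap k (conv h p q) = conv h' (fmap k1 p) (fmap k2 q)"
proof (induction p rule: formal_induct_UNIV)
  case (single x)
  show ?case
    by (induction q rule: formal_induct_UNIV) (simp_all add: assms)
qed simp_all

lemma conv_assoc:
  assumes "\<And>x y z. h (h x y) z = h x (h y z)"
  shows "conv h (conv h p q) r = conv h p (conv h q r)"
proof (induction p rule: formal_induct_UNIV)
  case (single x)
  show ?case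
    \<comment> \<open>Associativity says that left multiplication by \<open>x\<close> intertwines
      \<open>h\<close> with itself when it acts on the left factor and the identity acts on the
      right one.\<close>
    using fmap_conv[of "h x" h h "h x" "\<lambda>x. x" q r] assms
    by simp
qed simp_all


section \<open>The relations of the tensor square and cube\<close>

text \<open>Collecting the insertion maps into a set allows one theory of relations to serve both
  the square and the cube.\<close>

definition slots2 :: "('a \<Rightarrow> 'a \<times> 'a) set" where
  "slots2 = range (\<lambda>b x. (x, b)) \<union> range (\<lambda>a x. (a, x))"

definition slots3 :: "('a \<Rightarrow> 'a \<times> 'a \<times> 'a) set" where
  "slots3 = range (\<lambda>(b, c) x. (x, b, c)) \<union> range (\<lambda>(a, c) x. (a, x, c))
     \<union> range (\<lambda>(a, b) x. (a, b, x))"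

definition rels ::
    "('k::field \<Rightarrow> 'a::ring_1 \<Rightarrow> 'a) \<Rightarrow> ('a \<Rightarrow> 'x) set \<Rightarrow> ('x \<Rightarrow>\<^sub>0 'k) set" where
  "rels s G = formal.span (\<Union>g\<in>G. slot_rels s g)"

lemma rels2_eq: "rels2 s = rels s slots2"
  by (simp add: rels2_def rels_def slots2_def image_Un image_image)

lemma rels3_eq: "rels3 s = rels s slots3"
  unfolding rels3_def rels_def slots3_def by (rule arg_cong[where f = formal.span]) force

lemma subspace_rels: "formal.subspace (rels s G)"
  by (simp add: rels_def)

lemma slot_add_rels:
  "g \<in> G \<Longrightarrow> single (g (a + b)) - single (g a) - single (g b) \<in> rels s G"
  unfolding rels_def slot_rels_def by (rule formal.span_base) blast

lemma slot_scale_rels: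
  "g \<in> G \<Longrightarrow> single (g (s c a)) - fscale c (single (g a)) \<in> rels s G"
  unfolding rels_def slot_rels_def by (rule formal.span_base) blast

text \<open>The preimage of \<open>N\<close> under a linear map is a subspace, so it contains the
  span as soon as it contains the generators. Taking \<open>N\<close> to be zero gives equalities;
  taking \<open>N\<close> to be another relation space gives congruences.\<close>

lemma (in vector_space) lin_rels:
  assumes "subspace N"
    and "\<And>g a b. g \<in> G \<Longrightarrow> f (g (a + b)) - f (g a) - f (g b) \<in> N"
    and "\<And>g c a. g \<in> G \<Longrightarrow> f (g (s c a)) - scale c (f (g a)) \<in> N"
    and "p \<in> rels s G"
  shows "lin scale f p \<in> N"
proof -
  have "formal.subspace {p. lin scale f p \<in> N}"
    using assms(1)
    by (auto simp: formal.subspace_def lin_add lin_fscale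
        intro: subspace_0 subspace_add subspace_scale)
  then have "rels s G \<subseteq> {p. lin scale f p \<in> N}"
    unfolding rels_def
    by (intro formal.span_minimal)
      (auto simp: slot_rels_def lin_diff lin_fscale assms(2,3))
  with assms(4) show ?thesis
    by blast
qed

section \<open>Congruence modulo the relations\<close>

definition eqv ::
    "('k::field \<Rightarrow> 'a::ring_1 \<Rightarrow> 'a) \<Rightarrow> ('a \<Rightarrow> 'x) set \<Rightarrow> ('x \<Rightarrow>\<^sub>0 'k) \<Rightarrow> ('x \<Rightarrow>\<^sub>0 'k) \<Rightarrow> bool" where
  "eqv s G p q \<longleftrightarrow> p - q \<in> rels s G"

lemma eqv_refl [simp]: "eqv s G p p"
  using formal.subspace_0[OF subspace_rels] by (simp add: eqv_def)

lemma eqv_sym: "eqv s G p q \<Longrightarrow> eqv s G q p"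
  unfolding eqv_def using formal.subspace_neg[OF subspace_rels] by fastforce

lemma eqv_trans [trans]: "eqv s G p q \<Longrightarrow> eqv s G q r \<Longrightarrow> eqv s G p r"
  unfolding eqv_def using formal.subspace_add[OF subspace_rels, of "p - q" s G "q - r"] by simp

lemma eqv_add: "eqv s G p q \<Longrightarrow> eqv s G p' q' \<Longrightarrow> eqv s G (p + p') (q + q')"
  unfolding eqv_def using formal.subspace_add[OF subspace_rels, of "p - q" s G "p' - q'"]
  by (simp add: algebra_simps)

lemma eqv_fscale: "eqv s G p q \<Longrightarrow> eqv s G (fscale c p) (fscale c q)"
  unfolding eqv_def using formal.subspace_scale[OF subspace_rels, of "p - q" s G c]
  by (simp add: formal.scale_right_diff_distrib)

lemma (in vector_space) lin_eqv:
  assumes "\<And>g a b. g \<in> G \<Longrightarrow> f (g (a + b)) = f (g a) + f (g b)"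
    and "\<And>g c a. g \<in> G \<Longrightarrow> f (g (s c a)) = scale c (f (g a))"
    and "eqv s G p q"
  shows "lin scale f p = lin scale f q"
  using lin_rels[of "{0}" G f s "p - q"] assms by (simp add: eqv_def lin_diff)

lemma lin_fscale_eqv:
  assumes "\<And>g a b. g \<in> G \<Longrightarrow> eqv s G' (f (g (a + b))) (f (g a) + f (g b))"
    and "\<And>g c a. g \<in> G \<Longrightarrow> eqv s G' (f (g (s c a))) (fscale c (f (g a)))"
    and "eqv s G p q"
  shows "eqv s G' (lin fscale f p) (lin fscale f q)"
  using formal.lin_rels[OF subspace_rels, of G f s G' s "p - q"] assms
  by (simp add: eqv_def formal.lin_diff algebra_simps)

text \<open>A sufficient condition for the push-forward along \<open>h\<close> to descend to
  tensors: varying one entry of the source varies one entry of the target, through a linear map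
  \<open>l\<close>. Multiplication by a fixed tuple is the typical case.\<close>

definition slotwise ::
    "('k::field \<Rightarrow> 'a::ring_1 \<Rightarrow> 'a) \<Rightarrow> ('a \<Rightarrow> 'x) set \<Rightarrow> ('a \<Rightarrow> 'y) set \<Rightarrow> ('x \<Rightarrow> 'y) \<Rightarrow> bool" where
  "slotwise s G G' h \<longleftrightarrow>
     (\<forall>g\<in>G. \<exists>g'\<in>G'. \<exists>l. (\<forall>x. h (g x) = g' (l x)) \<and>
        (\<forall>a b. l (a + b) = l a + l b) \<and> (\<forall>c a. l (s c a) = s c (l a)))"

lemma slotwiseE:
  assumes "slotwise s G G' h" "g \<in> G"
  obtains g' l where "g' \<in> G'" "\<And>x. h (g x) = g' (l x)"
    "\<And>a b. l (a + b) = l a + l b" "\<And>c a. l (s c a) = s c (l a)"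
  using assms unfolding slotwise_def by blast

lemma slot_add_eqv: "g \<in> G \<Longrightarrow> eqv s G (single (g (a + b))) (single (g a) + single (g b))"
  using slot_add_rels[of g G a b s] by (simp add: eqv_def algebra_simps)

lemma slot_scale_eqv: "g \<in> G \<Longrightarrow> eqv s G (single (g (s c a))) (fscale c (single (g a)))"
  using slot_scale_rels[of g G s c a] by (simp add: eqv_def)

lemma fmap_eqv:
  assumes "slotwise s G G' h" "eqv s G p q"
  shows "eqv s G' (fmap h p) (fmap h q)"
  unfolding fmap_def
proof (rule lin_fscale_eqv[OF _ _ assms(2)])
  fix g a b assume "g \<in> G"
  with assms(1) show "eqv s G' (single (h (g (a + b)))) (single (h (g a)) + single (h (g b)))"
    by (elim slotwiseE[of s G G' h g]) (auto simp: slot_add_eqv)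
next
  fix g c a assume "g \<in> G"
  with assms(1) show "eqv s G' (single (h (g (s c a)))) (fscale c (single (h (g a))))"
    by (elim slotwiseE[of s G G' h g]) (auto simp: slot_scale_eqv)
qed

text \<open>One factor is replaced at a time. With the other factor reduced to a basis element, the
  bilinear extension becomes a push-forward, to which \<open>fmap_eqv\<close> applies.\<close>

lemma conv_eqv:
  assumes "\<And>y. slotwise s G G (\<lambda>x. h x y)" "\<And>x. slotwise s G G (h x)"
    and "eqv s G p p'" "eqv s G q q'"
  shows "eqv s G (conv h p q) (conv h p' q')"
proof -
  have "eqv s G (conv h p q) (conv h p' q)"
    by (induction q rule: formal_induct_UNIV)
      (simp_all add: eqv_add eqv_fscale fmap_eqv[OF assms(1) assms(3)])
  also have "eqv s G \<dots> (conv h p' q')"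
    by (induction p' rule: formal_induct_UNIV)
      (simp_all add: eqv_add eqv_fscale fmap_eqv[OF assms(2) assms(4)])
  finally show ?thesis .
qed

text \<open>Here the slot holds the parameter of \<open>h\<close> and not an entry of
  \<open>p\<close>: tensoring a fixed \<open>p\<close> with an extra factor is additive in that
  factor, modulo the relations.\<close>

lemma fmap_slot_add:
  assumes "\<And>x. (\<lambda>b. h b x) \<in> G"
  shows "eqv s G (fmap (h (a + b)) p) (fmap (h a) p + fmap (h b) p)"
proof (induction p rule: formal_induct_UNIV)
  case (single x)
  then show ?case
    using slot_add_eqv[OF assms[of x], of s a b] by simp
next
  case (add p q)
  from eqv_add[OF this] show ?case
    by (simp add: algebra_simps)
next
  case (scale c p)
  from eqv_fscale[OF this, of c] show ?case
    by (simp add: formal.scale_right_distrib)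
qed simp

lemma fmap_slot_scale:
  assumes "\<And>x. (\<lambda>b. h b x) \<in> G"
  shows "eqv s G (fmap (h (s c b)) p) (fscale c (fmap (h b) p))"
proof (induction p rule: formal_induct_UNIV)
  case (single x)
  then show ?case
    using slot_scale_eqv[OF assms[of x], of s c b] by simp
next
  case (add p q)
  from eqv_add[OF this] show ?case
    by (simp add: formal.scale_right_distrib)
next
  case (scale d p)
  from eqv_fscale[OF this, of d] show ?case
    by (simp add: mult.commute)
qed simp

section \<open>Cosets and their representatives\<close>

lemma coset_eq_iff: "{r. eqv s G r p} = {r. eqv s G r q} \<longleftrightarrow> eqv s G p q"
  using eqv_refl[of s G] eqv_sym[of s G] eqv_trans[of s G] by blast

lemma rep_coset: "eqv s G (rep {r. eqv s G r p}) p"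
  unfolding rep_def using someI[of "\<lambda>r. r \<in> {r. eqv s G r p}" p] by simp

lemma cls2_coset: "cls2 s p = {r. eqv s slots2 r p}"
  by (simp add: cls2_def rels2_eq eqv_def)

lemma cls3_coset: "cls3 s p = {r. eqv s slots3 r p}"
  by (simp add: cls3_def rels3_eq eqv_def)

lemma cls2_eq_iff: "cls2 s p = cls2 s q \<longleftrightarrow> eqv s slots2 p q"
  by (simp only: cls2_coset coset_eq_iff)

lemma cls3_eq_iff: "cls3 s p = cls3 s q \<longleftrightarrow> eqv s slots3 p q"
  by (simp only: cls3_coset coset_eq_iff)

lemma rep_cls2: "eqv s slots2 (rep (cls2 s p)) p"
  by (simp only: cls2_coset rep_coset)

lemma rep_cls3: "eqv s slots3 (rep (cls3 s p)) p"
  by (simp only: cls3_coset rep_coset)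

section \<open>The algebra structure of the tensor square and cube\<close>

definition mul2 :: "'a::ring_1 \<times> 'a \<Rightarrow> 'a \<times> 'a \<Rightarrow> 'a \<times> 'a" where
  "mul2 = (\<lambda>(a, b) (a', b'). (a * a', b * b'))"

definition mul3 :: "'a::ring_1 \<times> 'a \<times> 'a \<Rightarrow> 'a \<times> 'a \<times> 'a \<Rightarrow> 'a \<times> 'a \<times> 'a" where
  "mul3 = (\<lambda>(a, b, c) (a', b', c'). (a * a', b * b', c * c'))"

definition put3 :: "'a \<Rightarrow> 'a \<times> 'a \<Rightarrow> 'a \<times> 'a \<times> 'a" where
  "put3 c = (\<lambda>(a, b). (a, b, c))"

lemma mul2_simp [simp]: "mul2 (a, b) (a', b') = (a * a', b * b')"
  by (simp add: mul2_def)

lemma mul3_simp [simp]: "mul3 (a, b, c) (a', b', c') = (a * a', b * b', c * c')"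
  by (simp add: mul3_def)

lemma put3_simp [simp]: "put3 c (a, b) = (a, b, c)"
  by (simp add: put3_def)

lemma mult2_eq: "mult2 s X Y = cls2 s (conv mul2 (rep X) (rep Y))"
  by (simp add: mult2_def conv_def mul2_def case_prod_unfold)

lemma mult3_eq: "mult3 s X Y = cls3 s (conv mul3 (rep X) (rep Y))"
  by (simp add: mult3_def conv_def mul3_def case_prod_unfold)

lemma leg12_eq: "leg12 s X = cls3 s (fmap (put3 1) (rep X))"
  by (simp add: leg12_def fmap_def put3_def case_prod_unfold)

lemma leg23_eq: "leg23 s X = cls3 s (fmap (Pair 1) (rep X))"
  by (simp add: leg23_def fmap_def case_prod_unfold)

lemma slots3_simps [simp]:
  "(\<lambda>x. (x, b, c)) \<in> slots3" "(\<lambda>x. (a, x, c)) \<in> slots3" "(\<lambda>x. (a, b, x)) \<in> slots3"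
  by (auto simp: slots3_def)

lemma slots3_put3: "(\<lambda>c. put3 c x) \<in> slots3"
  by (cases x) simp

lemma slots3_Pair: "(\<lambda>a. (a, x)) \<in> slots3"
  by (cases x) simp

lemma slots2_simps [simp]: "(\<lambda>x. (x, b)) \<in> slots2" "Pair a \<in> slots2"
  by (auto simp: slots2_def)

lemma slots2E:
  assumes "g \<in> slots2"
  obtains b where "g = (\<lambda>x. (x, b))" | a where "g = Pair a"
  using assms by (auto simp: slots2_def)

lemma slotwise_put3: "slotwise s slots2 slots3 (put3 c)"
  by (force simp: slotwise_def slots2_def slots3_def)

lemma slotwise_Pair: "slotwise s slots2 slots3 (Pair a)"
  by (force simp: slotwise_def slots2_def slots3_def)

lemma conv_mul2_assoc: "conv mul2 (conv mul2 p q) r = conv mul2 p (conv mul2 q r)"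
  by (rule conv_assoc) (auto simp: mul2_def mult.assoc)

lemma conv_mul3_assoc: "conv mul3 (conv mul3 p q) r = conv mul3 p (conv mul3 q r)"
  by (rule conv_assoc) (auto simp: mul3_def mult.assoc)

locale scalar_algebra = vector_space s
  for s :: "'k::field \<Rightarrow> 'a::ring_1 \<Rightarrow> 'a" +
  assumes scalar_left: "s c a * b = s c (a * b)"
    and scalar_right: "a * s c b = s c (a * b)"
begin

text \<open>The linear map on the varying entry is multiplication by the matching entry of the fixed
  pair.\<close>

lemma slotwise_mul2:
  "slotwise s slots2 slots2 (mul2 x)" "slotwise s slots2 slots2 (\<lambda>x. mul2 x y)"
  by (cases x, force simp: slotwise_def slots2_def scalar_right distrib_left)
    (cases y, force simp: slotwise_def slots2_def scalar_left distrib_right)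

lemma slotwise_mul3:
  "slotwise s slots3 slots3 (mul3 x)" "slotwise s slots3 slots3 (\<lambda>x. mul3 x y)"
  by (cases x, force simp: slotwise_def slots3_def scalar_right distrib_left)
    (cases y, force simp: slotwise_def slots3_def scalar_left distrib_right)

lemma lin_conv_mult:
  assumes "\<And>x y. f (h x y) = f x * f y"
  shows "lin s f (conv h p q) = lin s f p * lin s f q"
proof (induction p rule: formal_induct_UNIV)
  case (single x)
  show ?case
    by (induction q rule: formal_induct_UNIV)
      (simp_all add: assms lin_add lin_fscale scalar_right distrib_left)
qed (simp_all add: lin_add lin_fscale scalar_left distrib_right)

text \<open>Independence of the product from representatives. The order \<open>(2,1)\<close> matches
  \<open>conv_eqv\<close>, which lets the left argument vary first.\<close>

lemmas conv_mul2_eqv = conv_eqv[OF slotwise_mul2(2,1)]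
lemmas conv_mul3_eqv = conv_eqv[OF slotwise_mul3(2,1)]

lemma mult2_cls2: "mult2 s (cls2 s p) (cls2 s q) = cls2 s (conv mul2 p q)"
  by (simp add: mult2_eq cls2_eq_iff conv_mul2_eqv rep_cls2)

lemma mult3_cls3: "mult3 s (cls3 s p) (cls3 s q) = cls3 s (conv mul3 p q)"
  by (simp add: mult3_eq cls3_eq_iff conv_mul3_eqv rep_cls3)

text \<open>The formal product is associative on the nose, and the representative chosen for an
  inner product may be exchanged for that formal product.\<close>

lemma mult2_assoc: "mult2 s (mult2 s X Y) Z = mult2 s X (mult2 s Y Z)"
proof -
  have "mult2 s (mult2 s X Y) Z = cls2 s (conv mul2 (conv mul2 (rep X) (rep Y)) (rep Z))"
    by (simp add: mult2_eq[of s X Y] mult2_eq[of s _ Z] cls2_eq_iff conv_mul2_eqv rep_cls2)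
  also have "\<dots> = mult2 s X (mult2 s Y Z)"
    by (simp add: mult2_eq[of s Y Z] mult2_eq[of s X] cls2_eq_iff conv_mul2_eqv
        conv_mul2_assoc eqv_sym[OF rep_cls2])
  finally show ?thesis .
qed

lemma mult3_assoc: "mult3 s (mult3 s X Y) Z = mult3 s X (mult3 s Y Z)"
proof -
  have "mult3 s (mult3 s X Y) Z = cls3 s (conv mul3 (conv mul3 (rep X) (rep Y)) (rep Z))"
    by (simp add: mult3_eq[of s X Y] mult3_eq[of s _ Z] cls3_eq_iff conv_mul3_eqv rep_cls3)
  also have "\<dots> = mult3 s X (mult3 s Y Z)"
    by (simp add: mult3_eq[of s Y Z] mult3_eq[of s X] cls3_eq_iff conv_mul3_eqv
        conv_mul3_assoc eqv_sym[OF rep_cls3])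
  finally show ?thesis .
qed

lemma mult2_one2:
  assumes "X \<in> square s UNIV"
  shows "mult2 s X (one2 s) = X" "mult2 s (one2 s) X = X"
proof -
  obtain p where p: "X = cls2 s p"
    using assms by (auto simp: square_def)
  have "(\<lambda>x. mul2 x (1, 1)) = (\<lambda>x::'a \<times> 'a. x)" "mul2 (1, 1) = (\<lambda>x::'a \<times> 'a. x)"
    by (auto simp: mul2_def)
  then show "mult2 s X (one2 s) = X" "mult2 s (one2 s) X = X"
    by (simp_all add: p one2_def mult2_cls2)
qed

lemma mult2_in_square: "mult2 s X Y \<in> square s UNIV"
  by (auto simp: mult2_eq square_def)

text \<open>Two-sided inverses are unique, by evaluating \<open>Y X Z\<close> in two ways. Hence the
  definite description in \<open>inv2\<close> denotes any inverse that has been found.\<close>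

lemma inv2_eq:
  assumes "Y \<in> square s UNIV" "inverses2 s X Y"
  shows "inv2 s X = Y"
  unfolding inv2_def
proof (rule the_equality)
  fix Z assume Z: "Z \<in> square s UNIV \<and> inverses2 s X Z"
  then have "Z = mult2 s (mult2 s Y X) Z"
    using assms by (simp add: mult2_one2 inverses2_def)
  also have "\<dots> = mult2 s Y (mult2 s X Z)"
    by (rule mult2_assoc)
  also have "\<dots> = Y"
    using assms Z by (simp add: mult2_one2 inverses2_def)
  finally show "Z = Y" .
qed (use assms in blast)

lemma inverses2_mult2:
  assumes "X \<in> square s UNIV" "Y \<in> square s UNIV" "X' \<in> square s UNIV" "Y' \<in> square s UNIV"
    and "inverses2 s X X'" "inverses2 s Y Y'"
  shows "inverses2 s (mult2 s X Y) (mult2 s Y' X')"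
proof -
  have "mult2 s (mult2 s X Y) (mult2 s Y' X') = mult2 s X (mult2 s (mult2 s Y Y') X')"
    by (simp add: mult2_assoc)
  moreover have "mult2 s (mult2 s Y' X') (mult2 s X Y) = mult2 s Y' (mult2 s (mult2 s X' X) Y)"
    by (simp add: mult2_assoc)
  ultimately show ?thesis
    using assms by (simp add: inverses2_def mult2_one2)
qed

text \<open>The third entries multiply as \<open>1 * 1 = 1\<close>, so \<open>put3 1\<close>
  intertwines the two componentwise products.\<close>

lemma leg12_mult2: "leg12 s (mult2 s X Y) = mult3 s (leg12 s X) (leg12 s Y)"
proof -
  have "eqv s slots3 (fmap (put3 1) (rep (mult2 s X Y)))
      (fmap (put3 1) (conv mul2 (rep X) (rep Y)))"
    by (simp add: mult2_eq fmap_eqv[OF slotwise_put3] rep_cls2)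
  moreover have "fmap (put3 1) (conv mul2 (rep X) (rep Y))
      = conv mul3 (fmap (put3 1) (rep X)) (fmap (put3 1) (rep Y))"
    by (rule fmap_conv) (auto simp: mul2_def)
  ultimately show ?thesis
    by (simp add: leg12_eq mult3_cls3 cls3_eq_iff)
qed

lemma leg23_mult2: "leg23 s (mult2 s X Y) = mult3 s (leg23 s X) (leg23 s Y)"
proof -
  have "eqv s slots3 (fmap (Pair 1) (rep (mult2 s X Y)))
      (fmap (Pair 1) (conv mul2 (rep X) (rep Y)))"
    by (simp add: mult2_eq fmap_eqv[OF slotwise_Pair] rep_cls2)
  moreover have "fmap (Pair 1) (conv mul2 (rep X) (rep Y))
      = conv mul3 (fmap (Pair 1) (rep X)) (fmap (Pair 1) (rep Y))"
    by (rule fmap_conv) (auto simp: mul2_def)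
  ultimately show ?thesis
    by (simp add: leg23_eq mult3_cls3 cls3_eq_iff)
qed

end

section \<open>Coproducts on one leg\<close>

text \<open>Below, \<open>d a\<close> is a chosen representative of a coproduct of \<open>a\<close>; such a choice is linear
  only modulo the relations.\<close>

definition comult12 ::
    "('a \<Rightarrow> ('a \<times> 'a \<Rightarrow>\<^sub>0 'k::field)) \<Rightarrow> ('a \<times> 'a \<Rightarrow>\<^sub>0 'k) \<Rightarrow> ('a \<times> 'a \<times> 'a \<Rightarrow>\<^sub>0 'k)" where
  "comult12 d = lin fscale (\<lambda>(a, b). fmap (put3 b) (d a))"

definition comult23 ::
    "('a \<Rightarrow> ('a \<times> 'a \<Rightarrow>\<^sub>0 'k::field)) \<Rightarrow> ('a \<times> 'a \<Rightarrow>\<^sub>0 'k) \<Rightarrow> ('a \<times> 'a \<times> 'a \<Rightarrow>\<^sub>0 'k)" where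
  "comult23 d = lin fscale (\<lambda>(a, b). fmap (Pair a) (d b))"

lemma comult12_simps [simp]:
  "comult12 d 0 = 0"
  "comult12 d (single (a, b)) = fmap (put3 b) (d a)"
  "comult12 d (p + q) = comult12 d p + comult12 d q"
  "comult12 d (fscale c p) = fscale c (comult12 d p)"
  by (simp_all add: comult12_def formal.lin_add formal.lin_fscale)

lemma comult23_simps [simp]:
  "comult23 d 0 = 0"
  "comult23 d (single (a, b)) = fmap (Pair a) (d b)"
  "comult23 d (p + q) = comult23 d p + comult23 d q"
  "comult23 d (fscale c p) = fscale c (comult23 d p)"
  by (simp_all add: comult23_def formal.lin_add formal.lin_fscale)

lemma comult_id_eq:
  "comult_id H X = cls3 (scl H) (comult12 (\<lambda>a. rep (comult H a)) (rep X))"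
  by (simp add: comult_id_def comult12_def fmap_def put3_def case_prod_unfold)

lemma id_comult_eq:
  "id_comult H X = cls3 (scl H) (comult23 (\<lambda>a. rep (comult H a)) (rep X))"
  by (simp add: id_comult_def comult23_def fmap_def case_prod_unfold)

lemma comult12_cong:
  assumes "Poly_Mapping.keys p \<subseteq> C \<times> C" "\<And>a. a \<in> C \<Longrightarrow> d a = d' a"
  shows "comult12 d p = comult12 d' p"
  unfolding comult12_def lin_def using assms by (intro sum.cong) auto

lemma comult23_cong:
  assumes "Poly_Mapping.keys p \<subseteq> C \<times> C" "\<And>a. a \<in> C \<Longrightarrow> d a = d' a"
  shows "comult23 d p = comult23 d' p"
  unfolding comult23_def lin_def using assms by (intro sum.cong) auto

definition linear_mod ::
    "('k::field \<Rightarrow> 'a::ring_1 \<Rightarrow> 'a) \<Rightarrow> ('a \<Rightarrow> ('a \<times> 'a \<Rightarrow>\<^sub>0 'k)) \<Rightarrow> bool" where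
  "linear_mod s d \<longleftrightarrow> (\<forall>a b. eqv s slots2 (d (a + b)) (d a + d b)) \<and>
     (\<forall>c a. eqv s slots2 (d (s c a)) (fscale c (d a)))"

lemma comult12_eqv:
  assumes "linear_mod s d" "eqv s slots2 p q"
  shows "eqv s slots3 (comult12 d p) (comult12 d q)"
  unfolding comult12_def
proof (rule lin_fscale_eqv[OF _ _ assms(2)], goal_cases)
  case (1 g a b)
  \<comment> \<open>If the first entry varies, additivity comes from \<open>d\<close>, pushed
    forward along \<open>put3\<close>. If the second varies, it comes from the third slot of the
    cube.\<close>
  then show ?case
    using assms(1) fmap_eqv[OF slotwise_put3, of s "d (a + b)" "d a + d b"]
    by (cases rule: slots2E) (auto simp: linear_mod_def fmap_slot_add[OF slots3_put3])
next
  case (2 g c a)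
  then show ?case
    using assms(1) fmap_eqv[OF slotwise_put3, of s "d (s c a)" "fscale c (d a)"]
    by (cases rule: slots2E) (auto simp: linear_mod_def fmap_slot_scale[where s = s, OF slots3_put3])
qed

lemma comult23_eqv:
  assumes "linear_mod s d" "eqv s slots2 p q"
  shows "eqv s slots3 (comult23 d p) (comult23 d q)"
  unfolding comult23_def
proof (rule lin_fscale_eqv[OF _ _ assms(2)], goal_cases)
  case (1 g a b)
  then show ?case
    using assms(1) fmap_eqv[OF slotwise_Pair, of s "d (a + b)" "d a + d b"]
    by (cases rule: slots2E) (auto simp: linear_mod_def fmap_slot_add[OF slots3_Pair])
next
  case (2 g c a)
  then show ?case
    using assms(1) fmap_eqv[OF slotwise_Pair, of s "d (s c a)" "fscale c (d a)"]
    by (cases rule: slots2E) (auto simp: linear_mod_def fmap_slot_scale[where s = s, OF slots3_Pair])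
qed

text \<open>On pure tensors both sides represent \<Delta>(a a') \<otimes> b b', because
  \<open>d\<close> is multiplicative modulo the relations. Bilinearity does the rest.\<close>

lemma comult12_conv:
  assumes "\<And>a b. eqv s slots2 (d (a * b)) (conv mul2 (d a) (d b))"
  shows "eqv s slots3 (comult12 d (conv mul2 p q)) (conv mul3 (comult12 d p) (comult12 d q))"
proof (induction p rule: formal_induct_UNIV)
  case (single x)
  show ?case
  proof (induction q rule: formal_induct_UNIV)
    case (single y)
    obtain a b a' b' where xy: "x = (a, b)" "y = (a', b')"
      by fastforce
    have "fmap (put3 (b * b')) (conv mul2 (d a) (d a'))
        = conv mul3 (fmap (put3 b) (d a)) (fmap (put3 b') (d a'))"
      by (rule fmap_conv) (auto simp: mul2_def)
    with fmap_eqv[OF slotwise_put3 assms[of a a'], of "b * b'"] show ?case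
      by (simp add: xy del: conv_simps(2,6) add: conv_simps(2)[of mul2])
  qed (simp_all add: eqv_add eqv_fscale del: conv_simps(2) add: conv_simps(2)[of mul2])
qed (simp_all add: eqv_add eqv_fscale)

lemma comult23_conv:
  assumes "\<And>a b. eqv s slots2 (d (a * b)) (conv mul2 (d a) (d b))"
  shows "eqv s slots3 (comult23 d (conv mul2 p q)) (conv mul3 (comult23 d p) (comult23 d q))"
proof (induction p rule: formal_induct_UNIV)
  case (single x)
  show ?case
  proof (induction q rule: formal_induct_UNIV)
    case (single y)
    obtain a b a' b' where xy: "x = (a, b)" "y = (a', b')"
      by fastforce
    have "fmap (Pair (a * a')) (conv mul2 (d b) (d b'))
        = conv mul3 (fmap (Pair a) (d b)) (fmap (Pair a') (d b'))"
      by (rule fmap_conv) (auto simp: mul2_def)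
    with fmap_eqv[OF slotwise_Pair assms[of b b'], of "a * a'"] show ?case
      by (simp add: xy del: conv_simps(2,6) add: conv_simps(2)[of mul2])
  qed (simp_all add: eqv_add eqv_fscale del: conv_simps(2) add: conv_simps(2)[of mul2])
qed (simp_all add: eqv_add eqv_fscale)

text \<open>On a pure tensor a \<otimes> b the third entry is \<open>1 * b = b * 1\<close> in either
  order, so the commutation of \<open>f\<close> with \<open>d a\<close> carries over to the cube.
  The support condition guarantees that \<open>a\<close> lies in \<open>C\<close>.\<close>

lemma comult12_commute:
  assumes "Poly_Mapping.keys p \<subseteq> C \<times> C"
    and "\<And>c. c \<in> C \<Longrightarrow> eqv s slots2 (conv mul2 f (d c)) (conv mul2 (d c) f)"
  shows "eqv s slots3 (conv mul3 (fmap (put3 1) f) (comult12 d p))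
           (conv mul3 (comult12 d p) (fmap (put3 1) f))"
  using assms(1)
proof (induction p rule: formal_induct)
  case (single x)
  then obtain a b where x: "x = (a, b)" "a \<in> C"
    by auto
  have "fmap (put3 b) (conv mul2 f (d a)) = conv mul3 (fmap (put3 1) f) (fmap (put3 b) (d a))"
    "fmap (put3 b) (conv mul2 (d a) f) = conv mul3 (fmap (put3 b) (d a)) (fmap (put3 1) f)"
    by (rule fmap_conv; force simp: mul2_def)+
  with fmap_eqv[OF slotwise_put3 assms(2)[OF x(2)], of b] show ?case
    by (simp add: x)
qed (simp_all add: eqv_add eqv_fscale)

lemma comult23_commute:
  assumes "Poly_Mapping.keys p \<subseteq> C \<times> C"
    and "\<And>c. c \<in> C \<Longrightarrow> eqv s slots2 (conv mul2 f (d c)) (conv mul2 (d c) f)"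
  shows "eqv s slots3 (conv mul3 (fmap (Pair 1) f) (comult23 d p))
           (conv mul3 (comult23 d p) (fmap (Pair 1) f))"
  using assms(1)
proof (induction p rule: formal_induct)
  case (single x)
  then obtain a b where x: "x = (a, b)" "b \<in> C"
    by auto
  have "fmap (Pair a) (conv mul2 f (d b)) = conv mul3 (fmap (Pair 1) f) (fmap (Pair a) (d b))"
    "fmap (Pair a) (conv mul2 (d b) f) = conv mul3 (fmap (Pair a) (d b)) (fmap (Pair 1) f)"
    by (rule fmap_conv; force simp: mul2_def)+
  with fmap_eqv[OF slotwise_Pair assms(2)[OF x(2)], of a] show ?case
    by (simp add: x)
qed (simp_all add: eqv_add eqv_fscale)


section \<open>Hopf algebras\<close>

context hopf_algebra
begin

abbreviation "\<Delta> a \<equiv> rep (comult H a)"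

sublocale scalar_algebra "scl H"
  using vector_space scl_mult_left scl_mult_right
  by (intro scalar_algebra.intro scalar_algebra_axioms.intro)

lemma counit_add: "counit H (a + b) = counit H a + counit H b"
  and counit_scl: "counit H (scl H c a) = c * counit H a"
  using counit_linear
  by (simp_all add: Vector_Spaces.linear_def module_hom_def module_hom_axioms_def)

text \<open>Additivity of the coproduct is an equation of cosets, which constrains chosen
  representatives only up to congruence.\<close>

lemma linear_mod_comult: "linear_mod (scl H) \<Delta>"
  by (simp add: linear_mod_def comult_add comult_scl add2_def scale2_def rep_cls2)

lemma comult_mult_eqv: "eqv (scl H) slots2 (\<Delta> (a * b)) (conv mul2 (\<Delta> a) (\<Delta> b))"
  by (simp add: comult_mult mult2_eq rep_cls2)

text \<open>The map \<epsilon> \<otimes> id is bilinear in the entries, hence well defined on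
  classes, and multiplicative on pure tensors because \<epsilon> is.\<close>

lemma counit_id_mult2: "counit_id H (mult2 (scl H) X Y) = counit_id H X * counit_id H Y"
proof -
  let ?f = "\<lambda>(a, b). scl H (counit H a) b"
  have "counit_id H (mult2 (scl H) X Y) = lin (scl H) ?f (conv mul2 (rep X) (rep Y))"
    unfolding counit_id_def mult2_eq
    by (rule lin_eqv[OF _ _ rep_cls2])
      (auto elim!: slots2E simp: counit_add counit_scl algebra_simps
        scale_left_distrib scale_right_distrib)
  also have "\<dots> = counit_id H X * counit_id H Y"
    unfolding counit_id_def
    by (rule lin_conv_mult) (auto simp: mul2_def counit_mult scalar_left scalar_right)
  finally show ?thesis .
qed

lemma id_counit_mult2: "id_counit H (mult2 (scl H) X Y) = id_counit H X * id_counit H Y"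
proof -
  let ?f = "\<lambda>(a, b). scl H (counit H b) a"
  have "id_counit H (mult2 (scl H) X Y) = lin (scl H) ?f (conv mul2 (rep X) (rep Y))"
    unfolding id_counit_def mult2_eq
    by (rule lin_eqv[OF _ _ rep_cls2])
      (auto elim!: slots2E simp: counit_add counit_scl algebra_simps
        scale_left_distrib scale_right_distrib)
  also have "\<dots> = id_counit H X * id_counit H Y"
    unfolding id_counit_def
    by (rule lin_conv_mult) (auto simp: mul2_def counit_mult scalar_left scalar_right mult.commute)
  finally show ?thesis .
qed

lemma comult_id_mult2:
  "comult_id H (mult2 (scl H) X Y) = mult3 (scl H) (comult_id H X) (comult_id H Y)"
proof -
  have "comult_id H (mult2 (scl H) X Y)
      = cls3 (scl H) (comult12 \<Delta> (conv mul2 (rep X) (rep Y)))"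
    by (simp add: comult_id_eq mult2_eq cls3_eq_iff comult12_eqv[OF linear_mod_comult rep_cls2])
  also have "\<dots> = mult3 (scl H) (comult_id H X) (comult_id H Y)"
    by (simp add: comult_id_eq mult3_cls3 cls3_eq_iff comult12_conv[OF comult_mult_eqv])
  finally show ?thesis .
qed

lemma id_comult_mult2:
  "id_comult H (mult2 (scl H) X Y) = mult3 (scl H) (id_comult H X) (id_comult H Y)"
proof -
  have "id_comult H (mult2 (scl H) X Y)
      = cls3 (scl H) (comult23 \<Delta> (conv mul2 (rep X) (rep Y)))"
    by (simp add: id_comult_eq mult2_eq cls3_eq_iff comult23_eqv[OF linear_mod_comult rep_cls2])
  also have "\<dots> = mult3 (scl H) (id_comult H X) (id_comult H Y)"
    by (simp add: id_comult_eq mult3_cls3 cls3_eq_iff comult23_conv[OF comult_mult_eqv])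
  finally show ?thesis .
qed

lemma leg_comult_commute:
  assumes "X \<in> square (scl H) C"
    and "\<And>c. c \<in> C \<Longrightarrow> mult2 (scl H) F (comult H c) = mult2 (scl H) (comult H c) F"
  shows "mult3 (scl H) (leg12 (scl H) F) (comult_id H X)
      = mult3 (scl H) (comult_id H X) (leg12 (scl H) F)"
    and "mult3 (scl H) (leg23 (scl H) F) (id_comult H X)
      = mult3 (scl H) (id_comult H X) (leg23 (scl H) F)"
proof -
  \<comment> \<open>The entries of \<open>rep X\<close> need not lie in \<open>C\<close>, so the
    argument moves to a representative supported on \<open>C \<times> C\<close>.\<close>
  obtain p where p: "X = cls2 (scl H) p" "Poly_Mapping.keys p \<subseteq> C \<times> C"
    using assms(1) by (auto simp: square_def)
  have comm: "eqv (scl H) slots2 (conv mul2 (rep F) (\<Delta> c)) (conv mul2 (\<Delta> c) (rep F))"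
    if "c \<in> C" for c
    using assms(2)[OF that] by (simp add: mult2_eq cls2_eq_iff)
  have eqs: "comult_id H X = cls3 (scl H) (comult12 \<Delta> p)"
    "id_comult H X = cls3 (scl H) (comult23 \<Delta> p)"
    by (simp_all add: comult_id_eq id_comult_eq p(1) cls3_eq_iff rep_cls2
        comult12_eqv[OF linear_mod_comult] comult23_eqv[OF linear_mod_comult])
  show "mult3 (scl H) (leg12 (scl H) F) (comult_id H X)
      = mult3 (scl H) (comult_id H X) (leg12 (scl H) F)"
    by (simp add: eqs leg12_eq mult3_cls3 cls3_eq_iff comult12_commute[OF p(2) comm])
  show "mult3 (scl H) (leg23 (scl H) F) (id_comult H X)
      = mult3 (scl H) (id_comult H X) (leg23 (scl H) F)"
    by (simp add: eqs leg23_eq mult3_cls3 cls3_eq_iff comult23_commute[OF p(2) comm])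
qed

text \<open>Multiplicativity of the legs and of both coproduct maps turns each side into a fourfold
  product, whose two middle factors commute by \<open>leg_comult_commute\<close>.\<close>

lemma twisting_element_mult2:
  assumes F: "twisting_element H B F" and G: "twisting_element H C G"
    and comm: "\<And>c. c \<in> C \<Longrightarrow> mult2 (scl H) F (comult H c) = mult2 (scl H) (comult H c) F"
  shows "twisting_element H UNIV (mult2 (scl H) G F)"
proof -
  let ?m2 = "mult2 (scl H)" and ?m3 = "mult3 (scl H)"
  let ?l12 = "leg12 (scl H)" and ?l23 = "leg23 (scl H)"
  have UNIV: "X \<in> square (scl H) UNIV" if "X \<in> square (scl H) A" for X A
    using that by (auto simp: square_def)
  obtain F' G' where "F' \<in> square (scl H) B" "inverses2 (scl H) F F'"
    "G' \<in> square (scl H) C" "inverses2 (scl H) G G'"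
    using F G by (auto simp: twisting_element_def)
  then have inv: "inverses2 (scl H) (?m2 G F) (?m2 F' G')"
    using F G by (intro inverses2_mult2) (auto simp: twisting_element_def intro: UNIV)
  have G_square: "G \<in> square (scl H) C"
    using G by (simp add: twisting_element_def)
  have "?m3 (?l12 (?m2 G F)) (comult_id H (?m2 G F))
      = ?m3 (?l12 G) (?m3 (?m3 (?l12 F) (comult_id H G)) (comult_id H F))"
    by (simp add: leg12_mult2 comult_id_mult2 mult3_assoc)
  \<comment> \<open>Swapping the middle factors puts the two sides of the cocycle equations for
    \<open>G\<close> and \<open>F\<close> next to each other; the swap is undone on the
    \<open>?l23\<close> side afterwards.\<close>
  also have "\<dots> = ?m3 (?m3 (?l12 G) (comult_id H G)) (?m3 (?l12 F) (comult_id H F))"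
    by (simp add: leg_comult_commute(1)[OF G_square comm] mult3_assoc)
  also have "\<dots> = ?m3 (?m3 (?l23 G) (id_comult H G)) (?m3 (?l23 F) (id_comult H F))"
    using F G by (simp add: twisting_element_def)
  also have "\<dots> = ?m3 (?l23 G) (?m3 (?m3 (?l23 F) (id_comult H G)) (id_comult H F))"
    by (simp add: leg_comult_commute(2)[OF G_square comm] mult3_assoc)
  also have "\<dots> = ?m3 (?l23 (?m2 G F)) (id_comult H (?m2 G F))"
    by (simp add: leg23_mult2 id_comult_mult2 mult3_assoc)
  finally show ?thesis
    using F G inv mult2_in_square
    by (auto simp: twisting_element_def counit_id_mult2 id_counit_mult2)
qed

section \<open>The twisted coproduct and its restriction to \<open>C\<close>\<close>

lemma twisted_simps [simp]:
  "scl (twisted H F) = scl H"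
  "counit (twisted H F) = counit H"
  "comult (twisted H F) a = mult2 (scl H) (mult2 (scl H) F (comult H a)) (inv2 (scl H) F)"
  "counit_id (twisted H F) = counit_id H"
  "id_counit (twisted H F) = id_counit H"
  by (simp_all add: twisted_def Let_def counit_id_def id_counit_def fun_eq_iff)

lemma linear_mod_comult_twisted: "linear_mod (scl H) (\<lambda>a. rep (comult (twisted H F) a))"
proof -
  let ?f = "rep F" and ?g = "rep (inv2 (scl H) F)"
  let ?d = "\<lambda>a. conv mul2 (conv mul2 ?f (\<Delta> a)) ?g"
  have tw: "eqv (scl H) slots2 (rep (comult (twisted H F) a)) (?d a)" for a
    by (auto simp: mult2_eq intro!: eqv_trans[OF rep_cls2] conv_mul2_eqv)
  have "eqv (scl H) slots2 (?d (a + b)) (?d a + ?d b)" for a b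
    using conv_mul2_eqv[OF conv_mul2_eqv[OF eqv_refl], of "\<Delta> (a + b)" "\<Delta> a + \<Delta> b" ?g ?g ?f]
      linear_mod_comult by (simp add: linear_mod_def)
  moreover have "eqv (scl H) slots2 (?d (scl H c a)) (fscale c (?d a))" for c a
    using conv_mul2_eqv[OF conv_mul2_eqv[OF eqv_refl], of "\<Delta> (scl H c a)" "fscale c (\<Delta> a)" ?g ?g ?f]
      linear_mod_comult by (simp add: linear_mod_def)
  ultimately show ?thesis
    unfolding linear_mod_def
    by (meson tw eqv_trans eqv_sym eqv_add eqv_fscale)
qed

lemma comult_twisted_commute:
  assumes "twisting_element H B F"
    and "mult2 (scl H) F (comult H c) = mult2 (scl H) (comult H c) F"
  shows "comult (twisted H F) c = comult H c"
proof -
  obtain F' where F': "F' \<in> square (scl H) B" "inverses2 (scl H) F F'"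
    using assms(1) by (auto simp: twisting_element_def)
  \<comment> \<open>The inverse found inside the square of \<open>B\<close> is also the inverse in
    the full square, which is the one used by \<open>twisted\<close>.\<close>
  then have "inv2 (scl H) F = F'"
    by (intro inv2_eq) (auto simp: square_def)
  with F'(2) show ?thesis
    by (simp add: assms(2) mult2_assoc inverses2_def mult2_one2 comult_closed)
qed

text \<open>For a representative of \<open>G\<close> supported on \<open>C \<times> C\<close>, both
  sides of the cocycle equation evaluate the coproduct only on \<open>C\<close>, where the twisted
  and original ones agree.\<close>

lemma twisting_element_twisted:
  assumes G: "twisting_element H C G"
    and eq: "\<And>c. c \<in> C \<Longrightarrow> comult (twisted H F) c = comult H c"
  shows "twisting_element (twisted H F) UNIV G"
proof -
  obtain p where p: "G = cls2 (scl H) p" "Poly_Mapping.keys p \<subseteq> C \<times> C"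
    using G by (auto simp: twisting_element_def square_def)
  let ?d = "\<lambda>a. rep (comult (twisted H F) a)"
  have d: "?d c = \<Delta> c" if "c \<in> C" for c
    by (simp only: eq[OF that])
  have "comult_id (twisted H F) G = cls3 (scl H) (comult12 ?d p)"
    \<comment> \<open>The twisted coproduct stays folded so that
      \<open>linear_mod_comult_twisted\<close> applies to it as it stands.\<close>
    by (simp del: twisted_simps(3) add: comult_id_eq p(1) cls3_eq_iff rep_cls2
        comult12_eqv[OF linear_mod_comult_twisted])
  also have "\<dots> = cls3 (scl H) (comult12 \<Delta> p)"
    using comult12_cong[OF p(2) d] by simp
  also have "\<dots> = comult_id H G"
    by (simp add: comult_id_eq p(1) cls3_eq_iff eqv_sym[OF rep_cls2]
        comult12_eqv[OF linear_mod_comult])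
  finally have 1: "comult_id (twisted H F) G = comult_id H G" .
  have "id_comult (twisted H F) G = cls3 (scl H) (comult23 ?d p)"
    by (simp del: twisted_simps(3) add: id_comult_eq p(1) cls3_eq_iff rep_cls2
        comult23_eqv[OF linear_mod_comult_twisted])
  also have "\<dots> = cls3 (scl H) (comult23 \<Delta> p)"
    using comult23_cong[OF p(2) d] by simp
  also have "\<dots> = id_comult H G"
    by (simp add: id_comult_eq p(1) cls3_eq_iff eqv_sym[OF rep_cls2]
        comult23_eqv[OF linear_mod_comult])
  finally have 2: "id_comult (twisted H F) G = id_comult H G" .
  have UNIV: "square (scl H) C \<subseteq> square (scl H) UNIV"
    by (auto simp: square_def)
  from G UNIV show ?thesis
    unfolding twisting_element_def by (auto simp: 1 2)
qed

end

theorem proposition1: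
  fixes H :: "('k::field, 'a::ring_1) hopf"
    and B C :: "'a set"
    and F\<^sub>B F\<^sub>C :: "('k, 'a) tensor2"
  assumes "hopf_algebra H"
    and "carrier_of H B F\<^sub>B"
    and "carrier_of H C F\<^sub>C"
    and "\<And>c. c \<in> C \<Longrightarrow>
           mult2 (scl H) F\<^sub>B (comult H c) = mult2 (scl H) (comult H c) F\<^sub>B"
  shows "(\<forall>c\<in>C. comult (twisted H F\<^sub>B) c = comult H c) \<and>
         twisting_element (twisted H F\<^sub>B) UNIV F\<^sub>C \<and>
         twisting_element H UNIV (mult2 (scl H) F\<^sub>C F\<^sub>B)"
proof -
  interpret hopf_algebra H
    by fact
  have FB: "twisting_element H B F\<^sub>B" and FC: "twisting_element H C F\<^sub>C"
    using assms(2,3) by (simp_all add: carrier_of_def)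
  have stable: "comult (twisted H F\<^sub>B) c = comult H c" if "c \<in> C" for c
    using FB assms(4)[OF that] by (rule comult_twisted_commute)
  then show ?thesis
    using twisting_element_twisted[OF FC stable] twisting_element_mult2[OF FB FC assms(4)]
    by blast
qed

end
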